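(* Let $A\in\mathbf{R}^{n\times n}$ be a stable matrix, let $V=\{b_1,\dots,b_M\}$ be a finite set of possible input matrix columns $b_i\in\mathbf{R}^n$, let $B_0$ be a (possibly empty) existing input matrix with $n$ rows, and for each $S\subseteq V$ let $W_S$ be the infinite-horizon controllability Gramian associated with $S$. Assume that $W_S$ is invertible for every $S\subseteq V$. Then the set function $f:2^V\to\mathbf{R}$ defined by $$f(S)=\log\det W_S$$ is submodular and monotone increasing.
   Context: A matrix $A$ is stable if all its eigenvalues have strictly negative real part (so $\dot x=Ax$ is asymptotically stable). For $S\subseteq V$, $B_S=[B_0\ \ b_s]_{s\in S}$ is the matrix formed by the columns of the fixed (possibly empty) matrix $B_0$ together with the columns in $S$. The infinite-horizon controllability Gramian associated with $S$ is $W_S=\int_0^\infty e^{A\tau}B_SB_S^Te^{A^T\tau}\,d\tau\in\mathbf{R}^{n\times n}$, which is the unique positive semidefinite solution of the Lyapunov equation $AW_S+W_SA^T+B_SB_S^T=0$. A set function $f:2^V\to\mathbf{R}$ is submodular if for all $X\subseteq Y\subseteq V$ and all $s\in V\setminus Y$, $f(X\cup\{s\})-f(X)\ge f(Y\cup\{s\})-f(Y)$. It is monotone increasing if $X\subseteq Y\subseteq V$ implies $f(X)\le f(Y)$. *)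

theory Defs
  imports "HOL-Analysis.Analysis"
begin

definition eigenvalue :: "real^'n^'n \<Rightarrow> complex \<Rightarrow> bool" where
  "eigenvalue A \<mu> \<longleftrightarrow>
     (\<exists>v :: complex^'n. v \<noteq> 0 \<and> map_matrix complex_of_real A *v v = \<mu> *s v)"

definition stable_matrix :: "real^'n^'n \<Rightarrow> bool" where
  "stable_matrix A \<longleftrightarrow> (\<forall>\<mu>. eigenvalue A \<mu> \<longrightarrow> Re \<mu> < 0)"

(* The library's power and times on type vec act componentwise, so the powers in the
   exponential series are iterated matrix products. *)
definition matrix_exp :: "real^'n^'n \<Rightarrow> real^'n^'n" where
  "matrix_exp A = (\<Sum>k. (1 / fact k) *\<^sub>R (((\<lambda>X. A ** X) ^^ k) (mat 1)))"

(* The number of columns of B_S depends on S, and B_0 may have no column at all, so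
   B_S = [B_0 b_s] is given by a column function together with a finite set of column
   indices. B_0 is the list of its columns; b is an indexed family, so that distinct
   indices may carry equal vectors. Index Inl j is the j-th column of B_0, and Inr s is
   the column b_s. *)
definition input_index :: "(real^'n) list \<Rightarrow> 'i set \<Rightarrow> (nat + 'i) set" where
  "input_index B0 S = Inl ` {..<length B0} \<union> Inr ` S"

definition input_column :: "(real^'n) list \<Rightarrow> ('i \<Rightarrow> real^'n) \<Rightarrow> nat + 'i \<Rightarrow> real^'n" where
  "input_column B0 b = case_sum (\<lambda>j. B0 ! j) b"

(* The matrix product of B_S and its transpose. *)
definition input_outer ::
  "(real^'n) list \<Rightarrow> ('i \<Rightarrow> real^'n) \<Rightarrow> 'i set \<Rightarrow> real^'n^'n" where
  "input_outer B0 b S =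
     (\<chi> i k. \<Sum>c\<in>input_index B0 S. input_column B0 b c $ i * input_column B0 b c $ k)"

definition gramian ::
  "real^'n^'n \<Rightarrow> (real^'n) list \<Rightarrow> ('i \<Rightarrow> real^'n) \<Rightarrow> 'i set \<Rightarrow> real^'n^'n" where
  "gramian A B0 b S =
     integral {0..} (\<lambda>\<tau>::real. matrix_exp (\<tau> *\<^sub>R A) ** input_outer B0 b S
                            ** matrix_exp (\<tau> *\<^sub>R transpose A))"

definition submodular :: "'i set \<Rightarrow> ('i set \<Rightarrow> real) \<Rightarrow> bool" where
  "submodular V f \<longleftrightarrow>
     (\<forall>X Y s. X \<subseteq> Y \<and> Y \<subseteq> V \<and> s \<in> V - Y \<longrightarrow>
        f (X \<union> {s}) - f X \<ge> f (Y \<union> {s}) - f Y)"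

definition monotone_increasing :: "'i set \<Rightarrow> ('i set \<Rightarrow> real) \<Rightarrow> bool" where
  "monotone_increasing V f \<longleftrightarrow> (\<forall>X Y. X \<subseteq> Y \<and> Y \<subseteq> V \<longrightarrow> f X \<le> f Y)"

end

theory Submission
  imports Defs
begin

text \<open>The Gramian is additive in the columns, so adding \<open>s\<close> to any set not containing it adds one
  and the same positive semidefinite matrix \<open>P\<close> to the Gramian. Writing \<open>X\<close> for \<open>W_X\<close> and \<open>X + Q\<close> for
  \<open>W_Y\<close>, submodularity is \<open>det (X + P + Q) * det X \<le> det (X + P) * det (X + Q)\<close>. As \<open>P\<close> is a sum of
  matrices \<open>v v\<^sup>T\<close>, this follows one rank-one update at a time from
  \<open>det (X + v v\<^sup>T) = det X * (1 + v\<^sup>T X\<inverse> v)\<close> and \<open>v\<^sup>T (X + Q)\<inverse> v \<le> v\<^sup>T X\<inverse> v\<close>. The integrals exist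
  because each Gramian is invertible.\<close>

section \<open>Positive semidefinite matrices and rank-one decompositions\<close>

definition outer :: "real^'n \<Rightarrow> real^'n \<Rightarrow> real^'n^'n" where
  "outer u v = (\<chi> i j. u $ i * v $ j)"

definition psd :: "real^'n^'n \<Rightarrow> bool" where
  "psd P \<longleftrightarrow> transpose P = P \<and> (\<forall>x. 0 \<le> x \<bullet> (P *v x))"

lemma outer_mult_vec: "outer u v *v x = (v \<bullet> x) *\<^sub>R u"
  by (simp add: outer_def vec_eq_iff matrix_vector_mult_def inner_vec_def sum_distrib_left sum_distrib_right ac_simps)

lemma transpose_add: "transpose (P + Q) = transpose P + transpose (Q :: real^'n^'m)"
  by (simp add: transpose_def vec_eq_iff)

lemma transpose_diff: "transpose (P - Q) = transpose P - transpose (Q :: real^'n^'m)"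
  by (simp add: transpose_def vec_eq_iff)

lemma symmetric_inner_swap:
  fixes P :: "real^'n^'n"
  assumes "transpose P = P"
  shows "x \<bullet> (P *v y) = y \<bullet> (P *v x)"
  by (metis assms dot_lmul_matrix inner_commute transpose_matrix_vector)

lemma psd_outer: "psd (outer v v)"
  by (auto simp: psd_def outer_mult_vec inner_commute)
    (simp add: outer_def transpose_def vec_eq_iff mult.commute)

lemma psd_add: "psd P \<Longrightarrow> psd Q \<Longrightarrow> psd (P + Q)"
  by (simp add: psd_def transpose_add matrix_vector_mult_add_rdistrib inner_add_right)

lemma psd_zero: "psd 0"
  by (simp add: psd_def) (simp add: transpose_def vec_eq_iff)

lemma psd_sum: "(\<And>i. i \<in> I \<Longrightarrow> psd (P i)) \<Longrightarrow> psd (\<Sum>i\<in>I. P i)"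
  by (induction I rule: infinite_finite_induct) (auto intro: psd_add psd_zero)

lemma psd_congruence:
  assumes "psd P"
  shows "psd (E ** P ** transpose E)"
proof -
  have "x \<bullet> ((E ** P ** transpose E) *v x) = (transpose E *v x) \<bullet> (P *v (transpose E *v x))" for x
    by (simp add: matrix_vector_mul_assoc[symmetric] dot_lmul_matrix)
  then show ?thesis
    using assms by (simp add: psd_def matrix_transpose_mul matrix_mul_assoc)
qed

lemma matrix_entry: "P $ i $ j = axis i 1 \<bullet> (P *v axis j (1::real))"
  by (simp add: inner_axis' matrix_vector_mult_basis column_def)

lemma psd_diag_nonneg: "psd P \<Longrightarrow> 0 \<le> P $ i $ i"
  by (simp add: psd_def matrix_entry)

text \<open>With a zero diagonal, the quadratic form at \<open>?e i + ?e j\<close> and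
  \<open>?e i - ?e j\<close> equals plus and minus twice the entry \<open>P $ i $ j\<close>; both
  are nonnegative, so the entry vanishes.\<close>

lemma psd_zero_diag:
  assumes P: "psd P" and diag: "\<And>i. P $ i $ i = 0"
  shows "P = 0"
proof -
  have "P $ i $ j = 0" for i j
  proof -
    let ?e = "\<lambda>k. axis k (1::real)"
    have sym: "P $ j $ i = P $ i $ j"
      using P by (metis psd_def matrix_entry symmetric_inner_swap)
    have "0 \<le> (?e i + ?e j) \<bullet> (P *v (?e i + ?e j))" "0 \<le> (?e i - ?e j) \<bullet> (P *v (?e i - ?e j))"
      using P by (auto simp: psd_def)
    then show ?thesis
      using sym diag[of i] diag[of j]
      by (simp add: algebra_simps inner_add_left inner_add_right inner_diff_left inner_diff_right
          matrix_entry[symmetric])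
  qed
  then show ?thesis by (simp add: vec_eq_iff)
qed

text \<open>A step of symmetric Gaussian elimination with a positive pivot \<open>P $ i $ i\<close>. It annihilates
  the pivot and keeps the zeros already on the diagonal.\<close>

lemma psd_eliminate:
  fixes P :: "real^'n^'n"
  assumes P: "psd P" and pos: "P $ i $ i > 0"
  obtains P' v where "psd P'" "P = P' + outer v v" "P' $ i $ i = 0"
    "\<And>j. P $ j $ j = 0 \<Longrightarrow> P' $ j $ j = 0"
proof -
  define e :: "real^'n" where "e = axis i 1"
  define p where "p = P $ i $ i"
  \<comment> \<open>The scaling gives \<open>outer v v\<close> the same \<open>i\<close>-th column
    as \<open>P\<close>.\<close>
  define v where "v = (1 / sqrt p) *\<^sub>R (P *v e)"
  define P' where "P' = P - outer v v"
  have p: "p > 0" "e \<bullet> (P *v e) = p"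
    using pos by (simp_all add: p_def e_def matrix_entry)
  have sym: "transpose P = P" using P by (simp add: psd_def)
  have quad: "x \<bullet> (P' *v x) = x \<bullet> (P *v x) - (x \<bullet> (P *v e))\<^sup>2 / p" for x
  proof -
    have "(v \<bullet> x) * (v \<bullet> x) = (x \<bullet> (P *v e))\<^sup>2 / p"
      using p by (simp add: v_def power2_eq_square inner_commute field_simps)
    then show ?thesis
      by (simp add: P'_def matrix_vector_mult_diff_rdistrib inner_diff_right outer_mult_vec inner_commute)
  qed
  have "0 \<le> x \<bullet> (P' *v x)" for x
  proof -
    \<comment> \<open>This \<open>t\<close> minimizes the form of \<open>P\<close> along the line
      \<open>x - t e\<close>; the minimum is exactly the form of \<open>P'\<close> at
      \<open>x\<close>.\<close>
    define t where "t = (x \<bullet> (P *v e)) / p"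
    have "0 \<le> (x - t *\<^sub>R e) \<bullet> (P *v (x - t *\<^sub>R e))"
      using P by (simp add: psd_def)
    also have "\<dots> = x \<bullet> (P *v x) - 2 * t * (x \<bullet> (P *v e)) + t\<^sup>2 * p"
      using p symmetric_inner_swap[OF sym, of e x]
      by (simp add: matrix_vector_mult_diff_distrib matrix_vector_mult_scaleR inner_diff_left
          inner_diff_right algebra_simps power2_eq_square)
    also have "\<dots> = x \<bullet> (P' *v x)"
      using p by (simp add: quad t_def power2_eq_square field_simps)
    finally show ?thesis .
  qed
  moreover have "transpose P' = P'"
    using psd_outer[of v] sym by (simp add: P'_def transpose_diff psd_def)
  ultimately have "psd P'" by (simp add: psd_def)
  moreover have "P' $ i $ i = 0"
    using p quad[of e] by (simp add: matrix_entry e_def[symmetric] power2_eq_square)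
  \<comment> \<open>Subtracting the square of \<open>v $ j\<close> from zero leaves a nonpositive
    entry, while \<open>psd P'\<close> makes it nonnegative.\<close>
  moreover have "P' $ j $ j = 0" if "P $ j $ j = 0" for j
    using psd_diag_nonneg[OF \<open>psd P'\<close>, of j] that
    by (auto simp: P'_def outer_def mult_le_0_iff)
  ultimately show ?thesis
    by (intro that[of P' v]) (simp_all add: P'_def)
qed

text \<open>Each elimination step splits off one \<open>outer v v\<close> and lowers the number of
  nonzero diagonal entries; when none is left, the matrix is zero. Claims about psd matrices thus
  reduce to rank-one updates.\<close>

lemma psd_induct [consumes 1, case_names zero rank_one]:
  fixes P :: "real^'n^'n"
  assumes "psd P" and zero: "R 0"
    and step: "\<And>P v. psd P \<Longrightarrow> R P \<Longrightarrow> R (P + outer v v)"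
  shows "R P"
  using assms(1)
proof (induction "card {i. P $ i $ i \<noteq> 0}" arbitrary: P rule: less_induct)
  case less
  show ?case
  proof (cases "\<forall>i. P $ i $ i = 0")
    case True
    then show ?thesis using psd_zero_diag[OF less.prems] zero by simp
  next
    case False
    then obtain i where i: "P $ i $ i \<noteq> 0" by blast
    then have "P $ i $ i > 0" using psd_diag_nonneg[OF less.prems, of i] by simp
    from psd_eliminate[OF less.prems this] obtain P' v where P': "psd P'" "P = P' + outer v v"
      "P' $ i $ i = 0" "\<And>j. P $ j $ j = 0 \<Longrightarrow> P' $ j $ j = 0" by metis
    have "{j. P' $ j $ j \<noteq> 0} \<subset> {j. P $ j $ j \<noteq> 0}"
      using P'(3,4) i by blast
    then have "card {j. P' $ j $ j \<noteq> 0} < card {j. P $ j $ j \<noteq> 0}"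
      by (intro psubset_card_mono) auto
    then have "R P'" using less.hyps P'(1) by blast
    then show ?thesis using step P'(1,2) by simp
  qed
qed

section \<open>Determinants of rank-one updates\<close>

text \<open>Cramer's rule for the identity, whose rows combine to \<open>x\<close> with the
  coefficients \<open>x $ i\<close>.\<close>

lemma det_replace_row_mat_1:
  fixes x :: "real^'n"
  shows "det (\<chi> i. if i = k then x else mat 1 $ i) = x $ k"
proof -
  have "(\<Sum>i\<in>UNIV. x $ i *s row i (mat 1 :: real^'n^'n)) = x"
    by (simp add: vec_eq_iff row_def mat_def if_distrib cong: if_cong)
  moreover have "row i (mat 1 :: real^'n^'n) = mat 1 $ i" for i
    by (simp add: row_def vec_eq_iff)
  ultimately show ?thesis
    using cramer_lemma_transpose[of k x "mat 1 :: real^'n^'n"] by (simp cong: if_cong)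
qed

text \<open>For \<open>u $ k \<noteq> 0\<close>, the matrix \<open>T\<close> that has \<open>u\<close> as its \<open>k\<close>-th column and agrees with the
  identity elsewhere conjugates \<open>mat 1 + outer u w\<close> to a matrix that differs from the identity in
  row \<open>k\<close> only.\<close>

lemma det_mat_1_plus_outer:
  fixes u w :: "real^'n"
  shows "det (mat 1 + outer u w) = 1 + u \<bullet> w"
proof (cases "u = 0")
  case True
  moreover have "outer 0 w = 0" by (simp add: outer_def vec_eq_iff)
  ultimately show ?thesis by simp
next
  case False
  then obtain k where k: "u $ k \<noteq> 0" by (auto simp: vec_eq_iff)
  define T where "T = transpose (\<chi> i. if i = k then u else mat 1 $ i)"
  define z where "z = w v* T"
  define D where "D = (\<chi> i. if i = k then axis k 1 + z else mat 1 $ i)"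
  have detT: "det T = u $ k" by (simp add: T_def det_replace_row_mat_1)
  have Tk: "T *v axis k 1 = u"
    by (simp add: matrix_vector_mult_basis column_def T_def transpose_def vec_eq_iff)
  have mat_row: "mat 1 $ i = axis i (1::real)" for i :: 'n
    by (simp add: mat_def axis_def vec_eq_iff)
  have D: "D *v x = x + (z \<bullet> x) *\<^sub>R axis k 1" for x
  proof -
    have "(D *v x) $ i = (x + (z \<bullet> x) *\<^sub>R axis k 1) $ i" for i
      unfolding matrix_vector_mul_component
      by (simp add: D_def mat_row inner_add_left inner_axis') (simp add: axis_def)
    then show ?thesis by (simp add: vec_eq_iff)
  qed
  \<comment> \<open>Both sides send \<open>x\<close> to
    \<open>T *v x + (w \<bullet> (T *v x)) *\<^sub>R u\<close>.\<close>
  have "(T ** D) *v x = ((mat 1 + outer u w) ** T) *v x" for x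
    by (simp add: matrix_vector_mul_assoc[symmetric] D matrix_vector_right_distrib Tk
        matrix_vector_mult_scaleR matrix_vector_mult_add_rdistrib outer_mult_vec z_def dot_lmul_matrix)
  then have "T ** D = (mat 1 + outer u w) ** T" by (simp add: matrix_eq)
  then have "det T * det D = det (mat 1 + outer u w) * det T" by (metis det_mul)
  then have "det (mat 1 + outer u w) = det D" using detT k by simp
  also have "\<dots> = 1 + z $ k" by (simp add: D_def det_replace_row_mat_1)
  also have "z $ k = z \<bullet> axis k 1" by (simp add: inner_axis)
  also have "\<dots> = u \<bullet> w" by (simp add: z_def dot_lmul_matrix Tk inner_commute[of u])
  finally show ?thesis .
qed

text \<open>The matrix determinant lemma without an inverse: the updated vector is given as
  \<open>X *v y\<close>, so \<open>X\<close> factors out on the left.\<close>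

lemma det_add_outer: "det (X + outer (X *v y) w) = det X * (1 + y \<bullet> w)"
proof -
  have "(X + outer (X *v y) w) *v x = (X ** (mat 1 + outer y w)) *v x" for x
    by (simp add: matrix_vector_mul_assoc[symmetric] matrix_vector_mult_add_rdistrib outer_mult_vec
        matrix_vector_right_distrib matrix_vector_mult_scaleR)
  then have "X + outer (X *v y) w = X ** (mat 1 + outer y w)" by (simp add: matrix_eq)
  then show ?thesis by (simp add: det_mul det_mat_1_plus_outer)
qed

lemma det_nonzero_solve:
  fixes X :: "real^'n^'n"
  assumes "det X \<noteq> 0"
  obtains y where "X *v y = v"
  using assms by (metis invertible_det_nz invertible_def matrix_vector_mul_assoc matrix_vector_mul_lid)

section \<open>Determinant inequalities for positive semidefinite matrices\<close>

text \<open>Each rank-one update multiplies the determinant by \<open>1 + y \<bullet> v\<close> with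
  \<open>(X + P) *v y = v\<close>, and \<open>y \<bullet> v\<close> is a value of the form of
  \<open>X + P\<close>. The determinant stays positive, so the next system is solvable.\<close>

lemma det_add_psd_mono:
  assumes "psd X" "det X > 0" "psd P"
  shows "det X \<le> det (X + P)"
  using assms(3)
proof (induction P rule: psd_induct)
  case (rank_one P v)
  then have pos: "det (X + P) > 0" using assms by simp
  then obtain y where y: "(X + P) *v y = v" by (metis det_nonzero_solve less_irrefl)
  have "psd (X + P)" using assms rank_one by (simp add: psd_add)
  then have "0 \<le> y \<bullet> v" using y by (auto simp: psd_def)
  then have "det (X + P) * 1 \<le> det (X + P) * (1 + y \<bullet> v)"
    using pos by (intro mult_left_mono) auto
  also have "\<dots> = det (X + P + outer v v)"
    using det_add_outer[of "X + P" y v] y by simp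
  finally show ?case using rank_one by (simp add: add.assoc)
qed simp

text \<open>Monotonicity starting from \<open>mat \<epsilon>\<close> gives a nonnegative determinant
  of \<open>mat \<epsilon> + P\<close>; letting \<epsilon> tend to 0 keeps it nonnegative, and
  invertibility excludes 0.\<close>

lemma det_psd_pos:
  fixes P :: "real^'n^'n"
  assumes P: "psd P" and "invertible P"
  shows "det P > 0"
proof -
  have "det (mat \<epsilon> + P) \<ge> 0" if "\<epsilon> > 0" for \<epsilon> :: real
  proof -
    have "(mat \<epsilon> :: real^'n^'n) *v x = \<epsilon> *\<^sub>R x" for x
      by (simp add: vec_eq_iff matrix_vector_mult_def mat_def if_distrib if_distribR cong: if_cong)
    then have "psd (mat \<epsilon> :: real^'n^'n)" using that by (simp add: psd_def)
    moreover have "det (mat \<epsilon> :: real^'n^'n) > 0"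
      using that by (subst det_diagonal) (auto simp: mat_def)
    ultimately show ?thesis using det_add_psd_mono P by fastforce
  qed
  then have "\<forall>\<^sub>F \<epsilon> in at_right 0. 0 \<le> det (mat \<epsilon> + P)"
    by (auto simp: eventually_at_right_less intro: eventually_mono[OF eventually_at_right_less])
  moreover have "((\<lambda>\<epsilon>. det (mat \<epsilon> + P)) \<longlongrightarrow> det (mat 0 + P)) (at_right 0)"
  proof -
    have "((\<lambda>\<epsilon>. (mat \<epsilon> + P) $ i $ j) \<longlongrightarrow> (mat 0 + P) $ i $ j) (at_right 0)" for i j
      by (cases "i = j") (auto simp: mat_def intro!: tendsto_eq_intros)
    then show ?thesis unfolding det_def by (intro tendsto_sum tendsto_mult tendsto_prod tendsto_const)
  qed
  ultimately have "0 \<le> det (mat 0 + P)"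
    by (intro tendsto_lowerbound[where F = "at_right (0::real)"]) auto
  moreover have "(mat 0 :: real^'n^'n) = 0" by (simp add: mat_def vec_eq_iff)
  moreover have "det P \<noteq> 0" using assms invertible_det_nz by blast
  ultimately show ?thesis by simp
qed

text \<open>Antitonicity of the inverse, tested at \<open>v\<close>, where \<open>y\<close> and \<open>z\<close> stand for \<open>X\<inverse>v\<close> and
  \<open>(X + Q)\<inverse>v\<close>. It is read off the nonnegative quadratic form of \<open>X\<close> at \<open>y - z\<close>.\<close>

lemma psd_inverse_antimono:
  assumes X: "psd X" and Q: "psd Q" and y: "X *v y = v" and z: "(X + Q) *v z = v"
  shows "z \<bullet> v \<le> y \<bullet> v"
proof -
  have Xz: "X *v z = v - Q *v z"
    using z by (simp add: matrix_vector_mult_add_rdistrib eq_diff_eq)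
  have zy: "y \<bullet> (X *v z) = z \<bullet> v"
    using X y symmetric_inner_swap[of X y z] by (simp add: psd_def)
  have "0 \<le> (y - z) \<bullet> (X *v (y - z))" using X by (simp add: psd_def)
  also have "\<dots> = y \<bullet> v - z \<bullet> v - z \<bullet> (Q *v z)"
    using zy Xz y by (simp add: matrix_vector_mult_diff_distrib inner_diff_left inner_diff_right)
  finally show ?thesis using Q unfolding psd_def by (smt (verit))
qed

lemma det_psd_submodular:
  assumes X: "psd X" "det X > 0" and Q: "psd Q" and P: "psd P"
  shows "det (X + P + Q) * det X \<le> det (X + P) * det (X + Q)"
  using P
proof (induction P rule: psd_induct)
  case (rank_one P v)
  have pXP: "psd (X + P)" using X rank_one psd_add by blast
  have XP: "det (X + P) > 0" using det_add_psd_mono[OF X rank_one(1)] X by simp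
  have XPQ: "det (X + P + Q) > 0" using det_add_psd_mono[OF pXP XP Q] XP by simp
  obtain y where y: "(X + P) *v y = v" using XP by (metis det_nonzero_solve less_irrefl)
  obtain z where z: "(X + P + Q) *v z = v" using XPQ by (metis det_nonzero_solve less_irrefl)
  have zv: "0 \<le> z \<bullet> v" using psd_add[OF pXP Q] z by (auto simp: psd_def)
  have le: "z \<bullet> v \<le> y \<bullet> v" by (rule psd_inverse_antimono[OF pXP Q y z])
  have "det (X + (P + outer v v) + Q) * det X = (det (X + P + Q) * det X) * (1 + z \<bullet> v)"
    using det_add_outer[of "X + P + Q" z v] z by (simp add: algebra_simps)
  also have "\<dots> \<le> (det (X + P) * det (X + Q)) * (1 + y \<bullet> v)"
    proof (rule mult_mono[OF rank_one.IH])
    \<comment> \<open>The upper product is nonnegative because the induction hypothesis bounds it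
      below by a product of positive determinants.\<close>
    have "0 \<le> det (X + P + Q) * det X" using X XPQ by simp
    then show "0 \<le> det (X + P) * det (X + Q)" using rank_one.IH by linarith
  qed (use le zv in auto)
  also have "\<dots> = det (X + (P + outer v v)) * det (X + Q)"
    using det_add_outer[of "X + P" y v] y by (simp add: algebra_simps)
  finally show ?case .
qed (simp add: mult.commute)

section \<open>Integrals of psd-valued functions\<close>

lemma bounded_linear_transpose: "bounded_linear (transpose :: real^'n^'m \<Rightarrow> real^'m^'n)"
  unfolding linear_conv_bounded_linear[symmetric]
  by (rule linearI) (simp_all add: transpose_add transpose_scalar)

lemma bounded_linear_quadratic_form: "bounded_linear (\<lambda>P :: real^'n^'n. x \<bullet> (P *v x))"
  unfolding linear_conv_bounded_linear[symmetric]
  by (rule linearI)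
    (simp_all add: matrix_vector_mult_add_rdistrib inner_add_right scaleR_matrix_vector_assoc[symmetric])

text \<open>Transposition and each quadratic form are bounded linear, hence commute with the
  integral, so both conditions of \<open>psd\<close> pass to it.\<close>

lemma psd_integral:
  fixes F :: "real \<Rightarrow> real^'n^'n"
  assumes F: "F integrable_on T" and psd: "\<And>t. t \<in> T \<Longrightarrow> psd (F t)"
  shows "psd (integral T F)"
proof -
  have "transpose (integral T F) = integral T (transpose \<circ> F)"
    using integral_linear[OF F bounded_linear_transpose] by simp
  also have "\<dots> = integral T F"
    using psd by (intro integral_cong) (simp add: psd_def)
  finally have "transpose (integral T F) = integral T F" .
  moreover have "0 \<le> x \<bullet> (integral T F *v x)" for x
  proof -
    have "0 \<le> integral T ((\<lambda>P. x \<bullet> (P *v x)) \<circ> F)"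
      using psd integrable_linear[OF F bounded_linear_quadratic_form]
      by (intro integral_nonneg) (auto simp: psd_def)
    then show ?thesis using integral_linear[OF F bounded_linear_quadratic_form] by metis
  qed
  ultimately show ?thesis by (simp add: psd_def)
qed

section \<open>The matrix exponential\<close>

text \<open>Left multiplication by \<open>A\<close> has some operator bound \<open>K\<close>, so the
  terms are dominated by those of the real exponential series at \<open>K\<close>, times
  \<open>norm (mat 1)\<close>.\<close>

lemma summable_matrix_exp:
  fixes A :: "real^'n^'n"
  shows "summable (\<lambda>k. (1 / fact k) *\<^sub>R (((\<lambda>X. A ** X) ^^ k) (mat 1)))"
proof -
  have "bounded_linear (\<lambda>X :: real^'n^'n. A ** X)"
    unfolding linear_conv_bounded_linear[symmetric]
    by (rule linearI) (simp_all add: matrix_add_ldistrib matrix_matrix_mult_def vec_eq_iff sum.distrib sum_distrib_left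
        algebra_simps)
  from bounded_linear.pos_bounded[OF this]
  obtain K where K: "K > 0" "\<And>X :: real^'n^'n. norm (A ** X) \<le> norm X * K" by auto
  have pow: "norm (((\<lambda>X. A ** X) ^^ k) (mat 1)) \<le> K ^ k * norm (mat 1 :: real^'n^'n)" for k
  proof (induction k)
    case (Suc k)
    have "norm (((\<lambda>X. A ** X) ^^ Suc k) (mat 1)) \<le> norm (((\<lambda>X. A ** X) ^^ k) (mat 1)) * K"
      using K(2) by simp
    also have "\<dots> \<le> K ^ k * norm (mat 1 :: real^'n^'n) * K"
      using Suc K(1) by (intro mult_right_mono) auto
    finally show ?case by (simp add: ac_simps)
  qed simp
  have "summable (\<lambda>k. inverse (fact k) * K ^ k * norm (mat 1 :: real^'n^'n))"
    by (intro summable_mult2 summable_exp)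
  then show ?thesis
  proof (rule summable_comparison_test'[where N = 0])
    fix k
    show "norm ((1 / fact k) *\<^sub>R (((\<lambda>X. A ** X) ^^ k) (mat 1)))
      \<le> inverse (fact k) * K ^ k * norm (mat 1 :: real^'n^'n)"
      using pow[of k] by (simp add: field_simps)
  qed
qed

lemma transpose_matrix_power:
  fixes A :: "real^'n^'n"
  shows "transpose (((\<lambda>X. A ** X) ^^ k) (mat 1)) = ((\<lambda>X. transpose A ** X) ^^ k) (mat 1)"
proof -
  \<comment> \<open>Transposition turns left multiplication into right multiplication; commuting the
    factor back restores the iterated form.\<close>
  have comm: "((\<lambda>X. B ** X) ^^ k) (mat 1) ** B = B ** ((\<lambda>X. B ** X) ^^ k) (mat 1)"
    for B :: "real^'n^'n" and k
    by (induction k) (simp_all add: matrix_mul_assoc[symmetric])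
  show ?thesis
    by (induction k) (simp_all add: matrix_transpose_mul comm)
qed

lemma matrix_exp_transpose: "matrix_exp (transpose A) = transpose (matrix_exp A)"
  unfolding matrix_exp_def
  using bounded_linear.suminf[OF bounded_linear_transpose summable_matrix_exp[of A]]
  by (simp add: transpose_scalar transpose_matrix_power)

section \<open>Gramians and their increments\<close>

lemma input_outer_eq_sum:
  "input_outer B0 b S = (\<Sum>c\<in>input_index B0 S. outer (input_column B0 b c) (input_column B0 b c))"
  by (simp add: input_outer_def outer_def vec_eq_iff)

lemma psd_input_outer: "psd (input_outer B0 b S)"
  unfolding input_outer_eq_sum by (intro psd_sum psd_outer)

text \<open>The columns of \<open>B0\<close> cancel, so the increment depends on \<open>X\<close>
  and \<open>Y\<close> only through \<open>Y - X\<close>.\<close>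

lemma input_outer_diff:
  assumes "X \<subseteq> Y" "finite Y"
  shows "input_outer B0 b Y - input_outer B0 b X = (\<Sum>s\<in>Y - X. outer (b s) (b s))"
proof -
  let ?g = "\<lambda>c. outer (input_column B0 b c) (input_column B0 b c)"
  have "input_index B0 Y - input_index B0 X = Inr ` (Y - X)"
    by (auto simp: input_index_def)
  moreover have "sum ?g (input_index B0 Y) - sum ?g (input_index B0 X)
      = sum ?g (input_index B0 Y - input_index B0 X)"
    using assms by (intro sum_diff[symmetric]) (auto simp: input_index_def)
  moreover have "sum ?g (Inr ` (Y - X)) = (\<Sum>s\<in>Y - X. outer (b s) (b s))"
    by (simp add: sum.reindex input_column_def)
  ultimately show ?thesis by (simp add: input_outer_eq_sum)
qed

text \<open>With the second exponential written as a transpose, the integrand is visibly a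
  congruence of a psd matrix.\<close>

definition gramian_integrand ::
  "real^'n^'n \<Rightarrow> (real^'n) list \<Rightarrow> ('i \<Rightarrow> real^'n) \<Rightarrow> 'i set \<Rightarrow> real \<Rightarrow> real^'n^'n" where
  "gramian_integrand A B0 b S \<tau> =
     matrix_exp (\<tau> *\<^sub>R A) ** input_outer B0 b S ** transpose (matrix_exp (\<tau> *\<^sub>R A))"

lemma gramian_eq_integral: "gramian A B0 b S = integral {0..} (gramian_integrand A B0 b S)"
  by (simp add: gramian_def gramian_integrand_def[abs_def] matrix_exp_transpose transpose_scalar[symmetric])

lemma gramian_integrand_diff:
  assumes "X \<subseteq> Y" "finite Y"
  shows "gramian_integrand A B0 b Y \<tau> - gramian_integrand A B0 b X \<tau> =
    matrix_exp (\<tau> *\<^sub>R A) ** (\<Sum>s\<in>Y - X. outer (b s) (b s)) ** transpose (matrix_exp (\<tau> *\<^sub>R A))"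
proof -
  have "E ** P ** G - E ** Q ** G = E ** (P - Q) ** G" for E P Q G :: "real^'n^'n"
    by (simp add: matrix_eq matrix_vector_mul_assoc[symmetric] matrix_vector_mult_diff_rdistrib
        matrix_vector_mult_diff_distrib)
  then show ?thesis
    unfolding gramian_integrand_def input_outer_diff[OF assms, of B0 b, symmetric] .
qed

text \<open>A Henstock--Kurzweil integral that does not exist is \<open>0\<close>, which is singular.\<close>

lemma invertible_gramian_integrable:
  fixes A :: "real^'n^'n"
  assumes "invertible (gramian A B0 b S)"
  shows "gramian_integrand A B0 b S integrable_on {0..}"
proof (rule ccontr)
  assume "\<not> ?thesis"
  then have "gramian A B0 b S = 0"
    by (simp add: gramian_eq_integral not_integrable_integral)
  moreover have "(0 :: real^'n^'n) = mat 0" by (simp add: mat_def vec_eq_iff)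
  ultimately have "det (gramian A B0 b S) = 0" by (metis det_0)
  then show False using assms invertible_det_nz by blast
qed

text \<open>The explicit integral depends on the sets only through \<open>Y - X\<close>, which lets
  increments over different base sets be identified.\<close>

lemma gramian_diff:
  assumes "X \<subseteq> Y" "finite Y" "invertible (gramian A B0 b X)" "invertible (gramian A B0 b Y)"
  shows "gramian A B0 b Y - gramian A B0 b X =
      integral {0..} (\<lambda>\<tau>. matrix_exp (\<tau> *\<^sub>R A) ** (\<Sum>s\<in>Y - X. outer (b s) (b s))
        ** transpose (matrix_exp (\<tau> *\<^sub>R A)))" (is ?eq)
    and "psd (gramian A B0 b Y - gramian A B0 b X)"
proof -
  let ?D = "\<lambda>\<tau>. matrix_exp (\<tau> *\<^sub>R A) ** (\<Sum>s\<in>Y - X. outer (b s) (b s))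
    ** transpose (matrix_exp (\<tau> *\<^sub>R A))"
  note int = assms(4,3)[THEN invertible_gramian_integrable]
  show eq: ?eq
    using integral_diff[OF int] by (simp add: gramian_eq_integral gramian_integrand_diff[OF assms(1,2)])
  have "?D integrable_on {0..}"
    using integrable_diff[OF int] by (simp add: gramian_integrand_diff[OF assms(1,2)])
  then show "psd (gramian A B0 b Y - gramian A B0 b X)"
    unfolding eq by (intro psd_integral psd_congruence psd_sum psd_outer)
qed

lemma gramian_psd_det_pos:
  assumes "invertible (gramian A B0 b S)"
  shows "psd (gramian A B0 b S)" "det (gramian A B0 b S) > 0"
proof -
  show "psd (gramian A B0 b S)"
    unfolding gramian_eq_integral using invertible_gramian_integrable[OF assms]
    by (rule psd_integral) (simp add: gramian_integrand_def psd_congruence psd_input_outer)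
  then show "det (gramian A B0 b S) > 0" using assms by (rule det_psd_pos)
qed

theorem theorem6:
  fixes A :: "real^'n^'n"
    and V :: "'i set"
    and b :: "'i \<Rightarrow> real^'n"
    and B0 :: "(real^'n) list"
  assumes "stable_matrix A"
    and "finite V"
    and "\<And>S. S \<subseteq> V \<Longrightarrow> invertible (gramian A B0 b S)"
  shows "submodular V (\<lambda>S. ln (det (gramian A B0 b S)))
       \<and> monotone_increasing V (\<lambda>S. ln (det (gramian A B0 b S)))"
proof -
  let ?W = "gramian A B0 b"
  have pos: "psd (?W S)" "det (?W S) > 0" if "S \<subseteq> V" for S
    using gramian_psd_det_pos[OF assms(3)[OF that]] by auto
  have diff: "psd (?W Y - ?W X)" if "X \<subseteq> Y" "Y \<subseteq> V" for X Y
    using that assms(2,3) finite_subset by (intro gramian_diff(2)) auto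
  have "ln (det (?W X)) \<le> ln (det (?W Y))" if "X \<subseteq> Y" "Y \<subseteq> V" for X Y
    using det_add_psd_mono[OF pos[of X] diff[OF that]] pos(2)[of X] pos(2)[of Y] that by simp
  moreover have "ln (det (?W (Y \<union> {s}))) - ln (det (?W Y)) \<le> ln (det (?W (X \<union> {s}))) - ln (det (?W X))"
    if h: "X \<subseteq> Y" "Y \<subseteq> V" "s \<in> V - Y" for X Y s
  proof -
    define P where "P = ?W (X \<union> {s}) - ?W X"
    define Q where "Q = ?W Y - ?W X"
    have sub: "X \<subseteq> V" "X \<union> {s} \<subseteq> V" "Y \<union> {s} \<subseteq> V" "finite (X \<union> {s})" "finite (Y \<union> {s})"
      using h assms(2) by (auto dest: finite_subset)
    \<comment> \<open>Since \<open>s\<close> lies in neither set, both increments are the integral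
      for the single column \<open>b s\<close>, hence the same matrix \<open>P\<close>.\<close>
    have "X \<union> {s} - X = {s}" "Y \<union> {s} - Y = {s}" using h by auto
    then have "?W (Y \<union> {s}) - ?W Y = P"
      using gramian_diff(1)[OF Un_upper1 sub(4), of A B0 b] gramian_diff(1)[OF Un_upper1 sub(5), of A B0 b]
        assms(3) sub(1-3) h(2) by (simp add: P_def)
    then have eq: "?W (Y \<union> {s}) = ?W X + P + Q" "?W (X \<union> {s}) = ?W X + P" "?W Y = ?W X + Q"
      by (auto simp: P_def Q_def algebra_simps)
    have "psd P" "psd Q"
      unfolding P_def Q_def using diff[OF Un_upper1 sub(2)] diff[OF h(1,2)] .
    then have "det (?W (Y \<union> {s})) * det (?W X) \<le> det (?W (X \<union> {s})) * det (?W Y)"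
      unfolding eq using det_psd_submodular pos sub by blast
    \<comment> \<open>All four determinants are positive, so the product inequality becomes one
      between sums of logarithms.\<close>
    then have "ln (det (?W (Y \<union> {s})) * det (?W X)) \<le> ln (det (?W (X \<union> {s})) * det (?W Y))"
      using pos(2) sub h by simp
    then show ?thesis
      using pos(2)[of "Y \<union> {s}"] pos(2)[of X] pos(2)[of "X \<union> {s}"] pos(2)[of Y] sub h
      by (simp add: ln_mult)
  qed
  ultimately show ?thesis
    unfolding submodular_def monotone_increasing_def by blast
qed

end
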